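(* Let $\mathsf{C}$ be a strict monoidal category with tensor product $\otimes$ and unit $\mathbb{1}$. The oplax classifier $\mathsf{opL}(\mathsf{C}):=\mathsf{L}(\mathsf{C}^{\mathrm{op}})^{\mathrm{op}}$ can be presented, as a strict monoidal category, as follows. Its monoid of objects is the free monoid on $\{\underline{x}\mid x\in\mathrm{Obj}\,\mathsf{C}\}$ with unit the empty list $\emptyset$. Its morphisms are generated (under composition and tensor product) by morphisms $\underline{f}:\underline{x}\to\underline{y}$ for all $x,y\in\mathrm{Obj}\,\mathsf{C}$ and $f\in\mathrm{Hom}_{\mathsf{C}}(x,y)$, morphisms $k_{x,z}:\underline{x\otimes z}\to\underline{x}\otimes\underline{z}$ for all $x,z\in\mathrm{Obj}\,\mathsf{C}$, and a morphism $q:\underline{\mathbb{1}}\to\emptyset$, subject to the relations (for all objects and all suitable morphisms of $\mathsf{C}$): (0) $\underline{\mathrm{id}_x}=\mathrm{id}_{\underline{x}}$; (1) $\underline{g}\circ\underline{f}=\underline{g\circ f}$ for composable $f,g$; (2) $(\underline{f}\otimes\underline{f'})\circ k_{x,x'}=k_{y,y'}\circ\underline{f\otimes f'}$ for $f:x\to y$, $f':x'\to y'$; (3) $(k_{x,z}\otimes\mathrm{id}_{\underline{w}})\circ k_{x\otimes z,w}=(\mathrm{id}_{\underline{x}}\otimes k_{z,w})\circ k_{x,z\otimes w}$; (4) $(\mathrm{id}_{\underline{x}}\otimes q)\circ k_{x,\mathbb{1}}=\mathrm{id}_{\underline{x}}$; (5) $(q\otimes\mathrm{id}_{\underline{x}})\circ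 k_{\mathbb{1},x}=\mathrm{id}_{\underline{x}}$.
   Context: For a strict monoidal category $\mathsf{C}$, $\mathsf{C}^{\mathrm{op}}$ denotes the opposite category (morphisms reversed) with the same tensor product on objects and morphisms and the same unit; it is again strict monoidal. For a strict monoidal category $\mathsf{C}$ with tensor product $\otimes$ and unit $\mathbb{1}$, $\mathsf{L}(\mathsf{C})$ is the strict monoidal category presented as follows. Its monoid of objects is the free monoid on the set of symbols $\{\underline{x} \mid x\in \mathrm{Obj}\,\mathsf{C}\}$, i.e. finite lists of symbols $\underline{x}$, with tensor product given by concatenation and monoidal unit the empty list $\emptyset$. Its morphisms are generated, as a strict monoidal category (under composition and tensor product), by: a morphism $\underline{f}:\underline{x}\to\underline{y}$ for every $x,y\in\mathrm{Obj}\,\mathsf{C}$ and $f\in \mathrm{Hom}_{\mathsf{C}}(x,y)$; a morphism $\ell_{x,z}:\underline{x}\otimes\underline{z}\to\underline{x\otimes z}$ for all $x,z\in \mathrm{Obj}\,\mathsf{C}$; and a morphism $j:\emptyset\to\underline{\mathbb{1}}$. They are subject to the relations (for all objects and all suitable morphisms of $\mathsf{C}$): (0) $\underline{\mathrm{id}_x}=\mathrm{id}_{\underline{x}}$; (1) $\underline{g}\circ\underline{f}=\underline{g\circ f}$ for composable $f,g$; (2) $\ell_{y,y'}\circ(\underline{f}\otimes\underline{f'})=\underline{f\otimes f'}\circ\ell_{x,x'}$ for $f:x\to y$, $f':x'\to y'$; (3) $\ell_{x\otimes z,w}\circ(\ell_{x,z}\otimes\mathrm{id}_{\underline{w}})=\ell_{x,z\otimes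 w}\circ(\mathrm{id}_{\underline{x}}\otimes\ell_{z,w})$; (4) $\ell_{x,\mathbb{1}}\circ(\mathrm{id}_{\underline{x}}\otimes j)=\mathrm{id}_{\underline{x}}$; (5) $\ell_{\mathbb{1},x}\circ(j\otimes\mathrm{id}_{\underline{x}})=\mathrm{id}_{\underline{x}}$. *)

theory Defs
  imports Main
begin

section \<open>Strict monoidal categories\<close>

record ('o, 'm) smcat =
  Obj :: "'o set"
  Arr :: "'m set"
  Dom :: "'m \<Rightarrow> 'o"
  Cod :: "'m \<Rightarrow> 'o"
  Ide :: "'o \<Rightarrow> 'm"
  Cmp :: "'m \<Rightarrow> 'm \<Rightarrow> 'm"  \<comment> \<open>\<open>Cmp C g f\<close> is \<open>g\<close> after \<open>f\<close>\<close>
  TenO :: "'o \<Rightarrow> 'o \<Rightarrow> 'o"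
  TenA :: "'m \<Rightarrow> 'm \<Rightarrow> 'm"
  One :: "'o"

definition Hom :: "('o, 'm) smcat \<Rightarrow> 'o \<Rightarrow> 'o \<Rightarrow> 'm set" where
  "Hom C x y = {f \<in> Arr C. Dom C f = x \<and> Cod C f = y}"

locale strict_monoidal_category =
  fixes C :: "('o, 'm) smcat"
  assumes dom_obj: "f \<in> Arr C \<Longrightarrow> Dom C f \<in> Obj C"
    and cod_obj: "f \<in> Arr C \<Longrightarrow> Cod C f \<in> Obj C"
    and ide_hom: "x \<in> Obj C \<Longrightarrow> Ide C x \<in> Hom C x x"
    and cmp_hom: "f \<in> Hom C x y \<Longrightarrow> g \<in> Hom C y z \<Longrightarrow> Cmp C g f \<in> Hom C x z"
    and cmp_ide_left: "f \<in> Hom C x y \<Longrightarrow> Cmp C (Ide C y) f = f"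
    and cmp_ide_right: "f \<in> Hom C x y \<Longrightarrow> Cmp C f (Ide C x) = f"
    and cmp_assoc: "f \<in> Hom C x y \<Longrightarrow> g \<in> Hom C y z \<Longrightarrow> h \<in> Hom C z w \<Longrightarrow>
      Cmp C (Cmp C h g) f = Cmp C h (Cmp C g f)"
    and one_obj: "One C \<in> Obj C"
    and tenO_obj: "x \<in> Obj C \<Longrightarrow> y \<in> Obj C \<Longrightarrow> TenO C x y \<in> Obj C"
    and tenO_assoc: "x \<in> Obj C \<Longrightarrow> y \<in> Obj C \<Longrightarrow> z \<in> Obj C \<Longrightarrow>
      TenO C (TenO C x y) z = TenO C x (TenO C y z)"
    and tenO_one_left: "x \<in> Obj C \<Longrightarrow> TenO C (One C) x = x"
    and tenO_one_right: "x \<in> Obj C \<Longrightarrow> TenO C x (One C) = x"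
    and tenA_hom: "f \<in> Hom C x y \<Longrightarrow> f' \<in> Hom C x' y' \<Longrightarrow>
      TenA C f f' \<in> Hom C (TenO C x x') (TenO C y y')"
    and tenA_ide: "x \<in> Obj C \<Longrightarrow> y \<in> Obj C \<Longrightarrow>
      TenA C (Ide C x) (Ide C y) = Ide C (TenO C x y)"
    and interchange: "f \<in> Hom C x y \<Longrightarrow> g \<in> Hom C y z \<Longrightarrow>
      f' \<in> Hom C x' y' \<Longrightarrow> g' \<in> Hom C y' z' \<Longrightarrow>
      TenA C (Cmp C g f) (Cmp C g' f') = Cmp C (TenA C g g') (TenA C f f')"
    and tenA_assoc: "f \<in> Arr C \<Longrightarrow> g \<in> Arr C \<Longrightarrow> h \<in> Arr C \<Longrightarrow>
      TenA C (TenA C f g) h = TenA C f (TenA C g h)"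
    and tenA_one_left: "f \<in> Arr C \<Longrightarrow> TenA C (Ide C (One C)) f = f"
    and tenA_one_right: "f \<in> Arr C \<Longrightarrow> TenA C f (Ide C (One C)) = f"

definition opcat :: "('o, 'm) smcat \<Rightarrow> ('o, 'm) smcat" where
  "opcat C = \<lparr>Obj = Obj C, Arr = Arr C, Dom = Cod C, Cod = Dom C, Ide = Ide C,
     Cmp = (\<lambda>g f. Cmp C f g), TenO = TenO C, TenA = TenA C, One = One C\<rparr>"

locale strict_monoidal_functor =
  S: strict_monoidal_category C + T: strict_monoidal_category D
  for C :: "('o, 'm) smcat" and D :: "('p, 'n) smcat" +
  fixes Fo :: "'o \<Rightarrow> 'p" and Fa :: "'m \<Rightarrow> 'n"
  assumes map_obj: "x \<in> Obj C \<Longrightarrow> Fo x \<in> Obj D"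
    and map_hom: "f \<in> Hom C x y \<Longrightarrow> Fa f \<in> Hom D (Fo x) (Fo y)"
    and map_ide: "x \<in> Obj C \<Longrightarrow> Fa (Ide C x) = Ide D (Fo x)"
    and map_cmp: "f \<in> Hom C x y \<Longrightarrow> g \<in> Hom C y z \<Longrightarrow>
      Fa (Cmp C g f) = Cmp D (Fa g) (Fa f)"
    and map_one: "Fo (One C) = One D"
    and map_tenO: "x \<in> Obj C \<Longrightarrow> y \<in> Obj C \<Longrightarrow> Fo (TenO C x y) = TenO D (Fo x) (Fo y)"
    and map_tenA: "f \<in> Arr C \<Longrightarrow> g \<in> Arr C \<Longrightarrow> Fa (TenA C f g) = TenA D (Fa f) (Fa g)"

locale strict_monoidal_iso = strict_monoidal_functor +
  assumes bij_obj: "bij_betw Fo (Obj C) (Obj D)"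
    and bij_arr: "bij_betw Fa (Arr C) (Arr D)"


section \<open>Presentations of strict monoidal categories\<close>

text \<open>Formal composites and tensor products of generating morphisms \<open>'g\<close>; the objects are words
  in the generating objects \<open>'x\<close>.\<close>

datatype ('x, 'g) tm =
    Idn "'x list"
  | Gen 'g
  | Comp "('x, 'g) tm" "('x, 'g) tm" (infixr "\<odot>" 55)
  | Tens "('x, 'g) tm" "('x, 'g) tm" (infixr "\<otimes>" 60)

record ('x, 'g) presentation =
  GObj :: "'x set"
  GArr :: "'g set"
  GSrc :: "'g \<Rightarrow> 'x list"
  GTgt :: "'g \<Rightarrow> 'x list"
  Rels :: "(('x, 'g) tm \<times> ('x, 'g) tm) set"

primrec src :: "('x, 'g) presentation \<Rightarrow> ('x, 'g) tm \<Rightarrow> 'x list" where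
  "src P (Idn a) = a"
| "src P (Gen g) = GSrc P g"
| "src P (t \<odot> u) = src P u"
| "src P (t \<otimes> u) = src P t @ src P u"

primrec tgt :: "('x, 'g) presentation \<Rightarrow> ('x, 'g) tm \<Rightarrow> 'x list" where
  "tgt P (Idn a) = a"
| "tgt P (Gen g) = GTgt P g"
| "tgt P (t \<odot> u) = tgt P t"
| "tgt P (t \<otimes> u) = tgt P t @ tgt P u"

primrec wf_tm :: "('x, 'g) presentation \<Rightarrow> ('x, 'g) tm \<Rightarrow> bool" where
  "wf_tm P (Idn a) \<longleftrightarrow> a \<in> lists (GObj P)"
| "wf_tm P (Gen g) \<longleftrightarrow> g \<in> GArr P"
| "wf_tm P (t \<odot> u) \<longleftrightarrow> wf_tm P t \<and> wf_tm P u \<and> src P t = tgt P u"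
| "wf_tm P (t \<otimes> u) \<longleftrightarrow> wf_tm P t \<and> wf_tm P u"

definition wf_presentation :: "('x, 'g) presentation \<Rightarrow> bool" where
  "wf_presentation P \<longleftrightarrow>
     (\<forall>g \<in> GArr P. GSrc P g \<in> lists (GObj P) \<and> GTgt P g \<in> lists (GObj P)) \<and>
     (\<forall>(t, u) \<in> Rels P. wf_tm P t \<and> wf_tm P u \<and> src P t = src P u \<and> tgt P t = tgt P u)"

text \<open>The least congruence on well-formed terms containing the relations and the axioms of strict
  monoidal categories.\<close>

inductive pcong :: "('x, 'g) presentation \<Rightarrow> ('x, 'g) tm \<Rightarrow> ('x, 'g) tm \<Rightarrow> bool"
  for P :: "('x, 'g) presentation" where
  refl: "wf_tm P t \<Longrightarrow> pcong P t t"
| sym: "pcong P t u \<Longrightarrow> pcong P u t"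
| trans: "pcong P t u \<Longrightarrow> pcong P u v \<Longrightarrow> pcong P t v"
| comp: "pcong P t t' \<Longrightarrow> pcong P u u' \<Longrightarrow> src P t = tgt P u \<Longrightarrow> pcong P (t \<odot> u) (t' \<odot> u')"
| tens: "pcong P t t' \<Longrightarrow> pcong P u u' \<Longrightarrow> pcong P (t \<otimes> u) (t' \<otimes> u')"
| rel: "(t, u) \<in> Rels P \<Longrightarrow> pcong P t u"
| id_left: "wf_tm P t \<Longrightarrow> pcong P (Idn (tgt P t) \<odot> t) t"
| id_right: "wf_tm P t \<Longrightarrow> pcong P (t \<odot> Idn (src P t)) t"
| comp_assoc: "wf_tm P (t \<odot> u \<odot> v) \<Longrightarrow> pcong P ((t \<odot> u) \<odot> v) (t \<odot> u \<odot> v)"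
| tens_id: "a \<in> lists (GObj P) \<Longrightarrow> b \<in> lists (GObj P) \<Longrightarrow> pcong P (Idn a \<otimes> Idn b) (Idn (a @ b))"
| interchange: "wf_tm P (t \<odot> u) \<Longrightarrow> wf_tm P (t' \<odot> u') \<Longrightarrow>
    pcong P ((t \<odot> u) \<otimes> (t' \<odot> u')) ((t \<otimes> t') \<odot> (u \<otimes> u'))"
| tens_assoc: "wf_tm P (t \<otimes> u \<otimes> v) \<Longrightarrow> pcong P ((t \<otimes> u) \<otimes> v) (t \<otimes> u \<otimes> v)"
| unit_left: "wf_tm P t \<Longrightarrow> pcong P (Idn [] \<otimes> t) t"
| unit_right: "wf_tm P t \<Longrightarrow> pcong P (t \<otimes> Idn []) t"

definition cls :: "('x, 'g) presentation \<Rightarrow> ('x, 'g) tm \<Rightarrow> ('x, 'g) tm set" where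
  "cls P t = {u. pcong P t u}"

definition presented :: "('x, 'g) presentation \<Rightarrow> ('x list, ('x, 'g) tm set) smcat" where
  "presented P = \<lparr>
     Obj = lists (GObj P),
     Arr = {t. wf_tm P t} // {(t, u). pcong P t u},
     Dom = (\<lambda>A. the_elem (src P ` A)),
     Cod = (\<lambda>A. the_elem (tgt P ` A)),
     Ide = (\<lambda>a. cls P (Idn a)),
     Cmp = (\<lambda>A B. \<Union>t\<in>A. \<Union>u\<in>B. cls P (t \<odot> u)),
     TenO = (@),
     TenA = (\<lambda>A B. \<Union>t\<in>A. \<Union>u\<in>B. cls P (t \<otimes> u)),
     One = []\<rparr>"

text \<open>\<open>D\<close> is presented by \<open>P\<close>, where \<open>io\<close> and \<open>ia\<close> say which objects and morphisms of \<open>D\<close> the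
  generators stand for: the functor out of \<open>presented P\<close> which they determine is an isomorphism.\<close>

definition is_presented_by ::
  "('o, 'm) smcat \<Rightarrow> ('x, 'g) presentation \<Rightarrow> ('x \<Rightarrow> 'o) \<Rightarrow> ('g \<Rightarrow> 'm) \<Rightarrow> bool" where
  "is_presented_by D P io ia \<longleftrightarrow> wf_presentation P \<and>
     (\<exists>Fo Fa. strict_monoidal_iso (presented P) D Fo Fa \<and>
        (\<forall>x \<in> GObj P. Fo [x] = io x) \<and>
        (\<forall>g \<in> GArr P. Fa (cls P (Gen g)) = ia g))"


section \<open>Lax and oplax classifiers\<close>

text \<open>Objects of \<open>C\<close> serve as their own symbols: the generating object that the literature
  writes as \<open>x\<close> underlined is the one-letter word \<open>[x]\<close>. The constructors \<open>LUnd\<close> and \<open>OUnd\<close>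
  below likewise stand for underlining a morphism.\<close>

datatype ('o, 'm) lax_gen = LUnd 'm | Lax 'o 'o | J

primrec lax_src :: "('o, 'm) smcat \<Rightarrow> ('o, 'm) lax_gen \<Rightarrow> 'o list" where
  "lax_src C (LUnd f) = [Dom C f]"
| "lax_src C (Lax x z) = [x, z]"
| "lax_src C J = []"

primrec lax_tgt :: "('o, 'm) smcat \<Rightarrow> ('o, 'm) lax_gen \<Rightarrow> 'o list" where
  "lax_tgt C (LUnd f) = [Cod C f]"
| "lax_tgt C (Lax x z) = [TenO C x z]"
| "lax_tgt C J = [One C]"

definition lax_rels ::
  "('o, 'm) smcat \<Rightarrow> (('o, ('o, 'm) lax_gen) tm \<times> ('o, ('o, 'm) lax_gen) tm) set" where
  "lax_rels C =
     {(Gen (LUnd (Ide C x)), Idn [x]) |x. x \<in> Obj C} \<union>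
     {(Gen (LUnd g) \<odot> Gen (LUnd f), Gen (LUnd (Cmp C g f))) |f g x y z.
        f \<in> Hom C x y \<and> g \<in> Hom C y z} \<union>
     {(Gen (Lax y y') \<odot> (Gen (LUnd f) \<otimes> Gen (LUnd f')),
       Gen (LUnd (TenA C f f')) \<odot> Gen (Lax x x')) |f f' x y x' y'.
        f \<in> Hom C x y \<and> f' \<in> Hom C x' y'} \<union>
     {(Gen (Lax (TenO C x z) w) \<odot> (Gen (Lax x z) \<otimes> Idn [w]),
       Gen (Lax x (TenO C z w)) \<odot> (Idn [x] \<otimes> Gen (Lax z w))) |x z w.
        x \<in> Obj C \<and> z \<in> Obj C \<and> w \<in> Obj C} \<union>
     {(Gen (Lax x (One C)) \<odot> (Idn [x] \<otimes> Gen J), Idn [x]) |x. x \<in> Obj C} \<union>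
     {(Gen (Lax (One C) x) \<odot> (Gen J \<otimes> Idn [x]), Idn [x]) |x. x \<in> Obj C}"

definition lax_presentation :: "('o, 'm) smcat \<Rightarrow> ('o, ('o, 'm) lax_gen) presentation" where
  "lax_presentation C = \<lparr>
     GObj = Obj C,
     GArr = LUnd ` Arr C \<union> {Lax x z |x z. x \<in> Obj C \<and> z \<in> Obj C} \<union> {J},
     GSrc = lax_src C,
     GTgt = lax_tgt C,
     Rels = lax_rels C\<rparr>"

lemma wf_lax_presentation:
  "strict_monoidal_category C \<Longrightarrow> wf_presentation (lax_presentation C)"
  unfolding strict_monoidal_category_def wf_presentation_def lax_presentation_def lax_rels_def
  by (auto simp: Hom_def)

definition lax_classifier ::
  "('o, 'm) smcat \<Rightarrow> ('o list, ('o, ('o, 'm) lax_gen) tm set) smcat" where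
  "lax_classifier C = presented (lax_presentation C)"

definition oplax_classifier ::
  "('o, 'm) smcat \<Rightarrow> ('o list, ('o, ('o, 'm) lax_gen) tm set) smcat" where
  "oplax_classifier C = opcat (lax_classifier (opcat C))"

datatype ('o, 'm) oplax_gen = OUnd 'm | K 'o 'o | Q

primrec oplax_src :: "('o, 'm) smcat \<Rightarrow> ('o, 'm) oplax_gen \<Rightarrow> 'o list" where
  "oplax_src C (OUnd f) = [Dom C f]"
| "oplax_src C (K x z) = [TenO C x z]"
| "oplax_src C Q = [One C]"

primrec oplax_tgt :: "('o, 'm) smcat \<Rightarrow> ('o, 'm) oplax_gen \<Rightarrow> 'o list" where
  "oplax_tgt C (OUnd f) = [Cod C f]"
| "oplax_tgt C (K x z) = [x, z]"
| "oplax_tgt C Q = []"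

definition oplax_rels ::
  "('o, 'm) smcat \<Rightarrow> (('o, ('o, 'm) oplax_gen) tm \<times> ('o, ('o, 'm) oplax_gen) tm) set" where
  "oplax_rels C =
     {(Gen (OUnd (Ide C x)), Idn [x]) |x. x \<in> Obj C} \<union>
     {(Gen (OUnd g) \<odot> Gen (OUnd f), Gen (OUnd (Cmp C g f))) |f g x y z.
        f \<in> Hom C x y \<and> g \<in> Hom C y z} \<union>
     {((Gen (OUnd f) \<otimes> Gen (OUnd f')) \<odot> Gen (K x x'),
       Gen (K y y') \<odot> Gen (OUnd (TenA C f f'))) |f f' x y x' y'.
        f \<in> Hom C x y \<and> f' \<in> Hom C x' y'} \<union>
     {((Gen (K x z) \<otimes> Idn [w]) \<odot> Gen (K (TenO C x z) w),
       (Idn [x] \<otimes> Gen (K z w)) \<odot> Gen (K x (TenO C z w))) |x z w.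
        x \<in> Obj C \<and> z \<in> Obj C \<and> w \<in> Obj C} \<union>
     {((Idn [x] \<otimes> Gen Q) \<odot> Gen (K x (One C)), Idn [x]) |x. x \<in> Obj C} \<union>
     {((Gen Q \<otimes> Idn [x]) \<odot> Gen (K (One C) x), Idn [x]) |x. x \<in> Obj C}"

definition oplax_presentation :: "('o, 'm) smcat \<Rightarrow> ('o, ('o, 'm) oplax_gen) presentation" where
  "oplax_presentation C = \<lparr>
     GObj = Obj C,
     GArr = OUnd ` Arr C \<union> {K x z |x z. x \<in> Obj C \<and> z \<in> Obj C} \<union> {Q},
     GSrc = oplax_src C,
     GTgt = oplax_tgt C,
     Rels = oplax_rels C\<rparr>"

text \<open>The morphisms of \<open>oplax_classifier C\<close> which the generators stand for. A morphism \<open>f\<close> of \<open>C\<close>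
  is the same element as the corresponding morphism of \<open>opcat C\<close>, and likewise for
  \<open>lax_classifier (opcat C)\<close> and its opposite.\<close>

primrec oplax_interp ::
  "('o, 'm) smcat \<Rightarrow> ('o, 'm) oplax_gen \<Rightarrow> ('o, ('o, 'm) lax_gen) tm set" where
  "oplax_interp C (OUnd f) = cls (lax_presentation (opcat C)) (Gen (LUnd f))"
| "oplax_interp C (K x z) = cls (lax_presentation (opcat C)) (Gen (Lax x z))"
| "oplax_interp C Q = cls (lax_presentation (opcat C)) (Gen J)"

end

(* Reversing the order of every formal composite, and renaming K to Lax and Q to J, is a
   bijection between the terms over the oplax generators of C and the terms over the lax generators of
   the opposite category. It exchanges sources with targets and the two sets of defining relations
   correspond to each other, so it identifies the two congruences. Passing to classes gives a
   contravariant isomorphism of the presented categories. *)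

theory Submission imports Defs begin

section \<open>Opposite categories\<close>

lemma opcat_simps [simp]:
  "Obj (opcat C) = Obj C" "Arr (opcat C) = Arr C" "Dom (opcat C) = Cod C" "Cod (opcat C) = Dom C"
  "Ide (opcat C) = Ide C" "Cmp (opcat C) g f = Cmp C f g" "TenO (opcat C) = TenO C"
  "TenA (opcat C) = TenA C" "One (opcat C) = One C"
  by (simp_all add: opcat_def)

lemma Hom_opcat [simp]: "Hom (opcat C) x y = Hom C y x"
  by (auto simp: Hom_def)

text \<open>Duality permutes the axioms: domain and codomain laws swap, as do the two identity laws,
  and associativity of composition is read backwards. The tensor axioms are self-dual.\<close>

lemma strict_monoidal_category_opcat:
  assumes "strict_monoidal_category C"
  shows "strict_monoidal_category (opcat C)"
proof -
  interpret strict_monoidal_category C by fact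
  show ?thesis
    by unfold_locales
      (simp_all only: opcat_simps Hom_opcat,
        (rule dom_obj cod_obj ide_hom cmp_hom cmp_ide_left cmp_ide_right cmp_assoc[symmetric] one_obj
          tenO_obj tenO_assoc tenO_one_left tenO_one_right tenA_hom tenA_ide interchange
          tenA_assoc tenA_one_left tenA_one_right; assumption)+)
qed


section \<open>The category defined by a presentation\<close>

lemma src_tgt_in_lists:
  assumes "wf_presentation P" "wf_tm P t"
  shows "src P t \<in> lists (GObj P)" "tgt P t \<in> lists (GObj P)"
  using assms(2) by (induction t) (use assms(1) in \<open>auto simp: wf_presentation_def\<close>)

text \<open>Makes source and target constant on congruence classes, so that \<open>Dom\<close> and
  \<open>Cod\<close> of a class can be read off any representative. The identity rules rely on
  \<open>src_tgt_in_lists\<close> for the added identity to be well formed.\<close>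

lemma pcong_wf:
  assumes "wf_presentation P" "pcong P t u"
  shows "wf_tm P t \<and> wf_tm P u \<and> src P t = src P u \<and> tgt P t = tgt P u"
  using assms(2)
proof induction
  case (rel t u)
  then show ?case
    using assms(1) by (auto simp: wf_presentation_def)
qed (auto simp: src_tgt_in_lists[OF assms(1)])

lemma cls_eqI: "pcong P t u \<Longrightarrow> cls P t = cls P u"
  by (auto simp: cls_def intro: pcong.sym pcong.trans)

lemma in_cls_self: "wf_tm P t \<Longrightarrow> t \<in> cls P t"
  by (simp add: cls_def pcong.refl)

lemma Obj_presented [simp]: "Obj (presented P) = lists (GObj P)"
  and Ide_presented [simp]: "Ide (presented P) a = cls P (Idn a)"
  and TenO_presented [simp]: "TenO (presented P) = (@)"
  and One_presented [simp]: "One (presented P) = []"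
  by (simp_all add: presented_def)

lemma Arr_presented: "Arr (presented P) = cls P ` {t. wf_tm P t}"
  by (auto simp: presented_def quotient_def cls_def)

lemma Dom_cls:
  assumes "wf_presentation P" "wf_tm P t"
  shows "Dom (presented P) (cls P t) = src P t"
proof -
  have "src P u = src P t" if "u \<in> cls P t" for u
    using that pcong_wf[OF assms(1), of t u] by (simp add: cls_def)
  with in_cls_self[OF assms(2)] have "src P ` cls P t = {src P t}"
    by blast
  then show ?thesis
    by (simp add: presented_def)
qed

lemma Cod_cls:
  assumes "wf_presentation P" "wf_tm P t"
  shows "Cod (presented P) (cls P t) = tgt P t"
proof -
  have "tgt P u = tgt P t" if "u \<in> cls P t" for u
    using that pcong_wf[OF assms(1), of t u] by (simp add: cls_def)
  with in_cls_self[OF assms(2)] have "tgt P ` cls P t = {tgt P t}"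
    by blast
  then show ?thesis
    by (simp add: presented_def)
qed

text \<open>Since \<open>pcong\<close> respects composition, all members of the union defining
  \<open>Cmp\<close> are one and the same class, and reflexivity makes the union nonempty.\<close>

lemma Cmp_cls:
  assumes "wf_tm P t" "wf_tm P u" "src P t = tgt P u"
  shows "Cmp (presented P) (cls P t) (cls P u) = cls P (t \<odot> u)"
proof -
  have "cls P (t \<odot> u) = cls P (t' \<odot> u')" if "t' \<in> cls P t" "u' \<in> cls P u" for t' u'
    by (rule cls_eqI[OF pcong.comp]) (use that assms(3) in \<open>simp_all add: cls_def\<close>)
  with in_cls_self[OF assms(1)] in_cls_self[OF assms(2)]
  have "(\<Union>t'\<in>cls P t. \<Union>u'\<in>cls P u. cls P (t' \<odot> u')) = cls P (t \<odot> u)"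
    by blast
  then show ?thesis
    by (simp add: presented_def)
qed

lemma TenA_cls:
  assumes "wf_tm P t" "wf_tm P u"
  shows "TenA (presented P) (cls P t) (cls P u) = cls P (t \<otimes> u)"
proof -
  have "cls P (t \<otimes> u) = cls P (t' \<otimes> u')" if "t' \<in> cls P t" "u' \<in> cls P u" for t' u'
    by (rule cls_eqI[OF pcong.tens]) (use that in \<open>simp_all add: cls_def\<close>)
  with in_cls_self[OF assms(1)] in_cls_self[OF assms(2)]
  have "(\<Union>t'\<in>cls P t. \<Union>u'\<in>cls P u. cls P (t' \<otimes> u')) = cls P (t \<otimes> u)"
    by blast
  then show ?thesis
    by (simp add: presented_def)
qed

lemma Hom_presented:
  assumes "wf_presentation P"
  shows "Hom (presented P) a b = cls P ` {t. wf_tm P t \<and> src P t = a \<and> tgt P t = b}"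
  by (auto simp: Hom_def Arr_presented Dom_cls[OF assms] Cod_cls[OF assms])

text \<open>After choosing representatives, each equational axiom is a rule of \<open>pcong\<close>
  or an identity of list concatenation.\<close>

theorem strict_monoidal_category_presented:
  assumes "wf_presentation P"
  shows "strict_monoidal_category (presented P)"
  by unfold_locales
    (auto simp: Hom_presented[OF assms] Arr_presented Dom_cls[OF assms] Cod_cls[OF assms]
      Cmp_cls TenA_cls src_tgt_in_lists[OF assms] pcong.id_left[THEN cls_eqI]
      pcong.id_right[THEN cls_eqI] pcong.comp_assoc[THEN cls_eqI] pcong.tens_id[THEN cls_eqI]
      pcong.interchange[THEN cls_eqI] pcong.tens_assoc[THEN cls_eqI]
      pcong.unit_left[THEN cls_eqI] pcong.unit_right[THEN cls_eqI]
      simp del: in_lists_conv_set del: in_listsI)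


section \<open>Reversal of terms\<close>

text \<open>Tensor factors keep their order because \<open>opcat\<close> reverses composition
  only.\<close>

primrec rev_tm :: "('g \<Rightarrow> 'h) \<Rightarrow> ('x, 'g) tm \<Rightarrow> ('x, 'h) tm" where
  "rev_tm \<phi> (Idn a) = Idn a"
| "rev_tm \<phi> (Gen g) = Gen (\<phi> g)"
| "rev_tm \<phi> (t \<odot> u) = rev_tm \<phi> u \<odot> rev_tm \<phi> t"
| "rev_tm \<phi> (t \<otimes> u) = rev_tm \<phi> t \<otimes> rev_tm \<phi> u"

lemma rev_tm_inverse: "(\<And>g. \<psi> (\<phi> g) = g) \<Longrightarrow> rev_tm \<psi> (rev_tm \<phi> t) = t"
  by (induction t) simp_all

text \<open>One direction of the correspondence. The source and target equations range over the
  whole generator type, so they extend to all terms by plain induction.\<close>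

locale reversal =
  fixes P :: "('x, 'g) presentation" and Q :: "('x, 'h) presentation" and \<phi> :: "'g \<Rightarrow> 'h"
  assumes wf_P: "wf_presentation P"
    and GObj_eq: "GObj Q = GObj P"
    and GArr_map: "g \<in> GArr P \<Longrightarrow> \<phi> g \<in> GArr Q"
    and GSrc_map: "GSrc Q (\<phi> g) = GTgt P g"
    and GTgt_map: "GTgt Q (\<phi> g) = GSrc P g"
    and Rels_map: "(t, u) \<in> Rels P \<Longrightarrow> (rev_tm \<phi> t, rev_tm \<phi> u) \<in> Rels Q"
begin

lemma src_rev_tm: "src Q (rev_tm \<phi> t) = tgt P t"
  and tgt_rev_tm: "tgt Q (rev_tm \<phi> t) = src P t"
  by (induction t) (simp_all add: GSrc_map GTgt_map)

lemma wf_rev_tm: "wf_tm P t \<Longrightarrow> wf_tm Q (rev_tm \<phi> t)"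
  by (induction t) (simp_all add: GObj_eq GArr_map src_rev_tm tgt_rev_tm)

text \<open>The rules are closed under reversal: \<open>id_left\<close> and \<open>id_right\<close>
  trade places, \<open>comp_assoc\<close> is used backwards, and every other rule goes to
  itself.\<close>

lemma pcong_rev_tm: "pcong P t u \<Longrightarrow> pcong Q (rev_tm \<phi> t) (rev_tm \<phi> u)"
proof (induction rule: pcong.induct)
  case (comp t t' u u')
  then show ?case
    using pcong_wf[OF wf_P] by (auto intro!: pcong.comp simp: src_rev_tm tgt_rev_tm)
next
  case (id_left t)
  then show ?case
    using pcong.id_right[OF wf_rev_tm] by (simp add: src_rev_tm)
next
  case (id_right t)
  then show ?case
    using pcong.id_left[OF wf_rev_tm] by (simp add: tgt_rev_tm)
next
  case (comp_assoc t u v)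
  then show ?case
    by (auto intro!: pcong.sym[OF pcong.comp_assoc] simp: wf_rev_tm src_rev_tm tgt_rev_tm)
next
  case (interchange t u t' u')
  then show ?case
    by (auto intro!: pcong.interchange simp: wf_rev_tm src_rev_tm tgt_rev_tm)
next
  case (tens_assoc t u v)
  then show ?case
    by (auto intro!: pcong.tens_assoc simp: wf_rev_tm)
qed (auto intro: pcong.intros simp: wf_rev_tm GObj_eq Rels_map)

end

locale reversal_bij =
  fwd: reversal P Q \<phi> + bwd: reversal Q P \<psi>
  for P :: "('x, 'g) presentation" and Q :: "('x, 'h) presentation" and \<phi> \<psi> +
  assumes \<psi>_\<phi>: "\<psi> (\<phi> g) = g"
    and \<phi>_\<psi>: "\<phi> (\<psi> h) = h"
begin

lemmas rev_rev = rev_tm_inverse[of \<psi> \<phi>, OF \<psi>_\<phi>] rev_tm_inverse[of \<phi> \<psi>, OF \<phi>_\<psi>]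

text \<open>Lets direct image serve as the map on arrows: a class goes onto a full class, because
  anything congruent to \<open>rev_tm \<phi> t\<close> can be pulled back along
  \<open>rev_tm \<psi>\<close>.\<close>

lemma image_rev_cls: "rev_tm \<phi> ` cls P t = cls Q (rev_tm \<phi> t)"
proof (intro equalityI subsetI)
  fix u assume "u \<in> cls Q (rev_tm \<phi> t)"
  then have "rev_tm \<psi> u \<in> cls P t"
    using bwd.pcong_rev_tm[of "rev_tm \<phi> t" u] by (simp add: cls_def rev_rev)
  then show "u \<in> rev_tm \<phi> ` cls P t"
    by (metis image_eqI rev_rev(2))
qed (auto simp: cls_def fwd.pcong_rev_tm)

lemma bij_betw_Arr:
  "bij_betw ((`) (rev_tm \<phi>)) (Arr (presented P)) (Arr (opcat (presented Q)))"
proof (rule bij_betw_imageI)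
  have "inj (rev_tm \<phi> :: ('x, 'g) tm \<Rightarrow> _)"
    by (metis injI rev_rev(1))
  then show "inj_on ((`) (rev_tm \<phi>)) (Arr (presented P))"
    by (meson inj_image_eq_iff inj_onI)
  \<comment> \<open>The preimage is the class of \<open>rev_tm \<psi> u\<close>.\<close>
  have "cls Q u \<in> (`) (rev_tm \<phi>) ` cls P ` {t. wf_tm P t}" if "wf_tm Q u" for u
    using that by (metis bwd.wf_rev_tm image_eqI image_rev_cls mem_Collect_eq rev_rev(2))
  then show "(`) (rev_tm \<phi>) ` Arr (presented P) = Arr (opcat (presented Q))"
    by (auto simp: Arr_presented image_rev_cls fwd.wf_rev_tm)
qed

text \<open>By \<open>image_rev_cls\<close> the functor laws reduce to the clauses of
  \<open>rev_tm\<close> on representatives; \<open>opcat\<close> absorbs the reversed order of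
  composition.\<close>

theorem strict_monoidal_iso_rev:
  "strict_monoidal_iso (presented P) (opcat (presented Q)) (\<lambda>a. a) ((`) (rev_tm \<phi>))"
proof -
  have "strict_monoidal_category (presented P)"
    "strict_monoidal_category (opcat (presented Q))"
    by (simp_all add: strict_monoidal_category_presented strict_monoidal_category_opcat
        fwd.wf_P bwd.wf_P)
  then show ?thesis
    by (intro strict_monoidal_iso.intro strict_monoidal_functor.intro
        strict_monoidal_functor_axioms.intro strict_monoidal_iso_axioms.intro)
      (auto simp: Hom_presented fwd.wf_P bwd.wf_P Arr_presented image_rev_cls Cmp_cls TenA_cls
        \<comment> \<open>Bijectivity is unfolded for the identity on words only; on arrows it is
          \<open>bij_betw_Arr\<close>. Removing \<open>equalityI\<close> keeps equations between
          classes whole for rewriting.\<close>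
        fwd.wf_rev_tm fwd.src_rev_tm fwd.tgt_rev_tm fwd.GObj_eq bij_betw_def[of "\<lambda>a. a"]
        bij_betw_Arr[unfolded Arr_presented opcat_simps] simp del: in_lists_conv_set
        del: equalityI)
qed

end


section \<open>The oplax classifier\<close>

primrec lax_of_oplax :: "('o, 'm) oplax_gen \<Rightarrow> ('o, 'm) lax_gen" where
  "lax_of_oplax (OUnd f) = LUnd f"
| "lax_of_oplax (K x z) = Lax x z"
| "lax_of_oplax Q = J"

primrec oplax_of_lax :: "('o, 'm) lax_gen \<Rightarrow> ('o, 'm) oplax_gen" where
  "oplax_of_lax (LUnd f) = OUnd f"
| "oplax_of_lax (Lax x z) = K x z"
| "oplax_of_lax J = Q"

lemma oplax_of_lax_inverse: "lax_of_oplax (oplax_of_lax g) = g"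
  and lax_of_oplax_inverse: "oplax_of_lax (lax_of_oplax h) = h"
  by (cases g; simp) (cases h; simp)

lemma wf_oplax_presentation:
  "strict_monoidal_category C \<Longrightarrow> wf_presentation (oplax_presentation C)"
  unfolding strict_monoidal_category_def wf_presentation_def oplax_presentation_def oplax_rels_def
  by (auto simp: Hom_def)

text \<open>Each family of relations reverses to its counterpart as ordered pairs. Functoriality
  matches after exchanging \<open>f\<close> and \<open>g\<close>, naturality after exchanging the
  sources and targets of \<open>f\<close> and \<open>f'\<close>; the others keep their
  objects.\<close>

lemma reversal_bij_oplax_lax:
  assumes "strict_monoidal_category C"
  shows "reversal_bij (oplax_presentation C) (lax_presentation (opcat C)) lax_of_oplax oplax_of_lax"
proof (intro reversal_bij.intro reversal.intro reversal_bij_axioms.intro)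
  show "wf_presentation (oplax_presentation C)"
    by (rule wf_oplax_presentation[OF assms])
  show "wf_presentation (lax_presentation (opcat C))"
    by (rule wf_lax_presentation[OF strict_monoidal_category_opcat[OF assms]])
  show "GSrc (lax_presentation (opcat C)) (lax_of_oplax g) = GTgt (oplax_presentation C) g"
    "GTgt (lax_presentation (opcat C)) (lax_of_oplax g) = GSrc (oplax_presentation C) g" for g
    by (cases g; simp add: oplax_presentation_def lax_presentation_def)+
  show "GSrc (oplax_presentation C) (oplax_of_lax h) = GTgt (lax_presentation (opcat C)) h"
    "GTgt (oplax_presentation C) (oplax_of_lax h) = GSrc (lax_presentation (opcat C)) h" for h
    by (cases h; simp add: oplax_presentation_def lax_presentation_def)+
  show "(rev_tm lax_of_oplax t, rev_tm lax_of_oplax u) \<in> Rels (lax_presentation (opcat C))"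
    if "(t, u) \<in> Rels (oplax_presentation C)" for t u
    using that by (auto simp: oplax_presentation_def lax_presentation_def oplax_rels_def lax_rels_def)
  show "(rev_tm oplax_of_lax t, rev_tm oplax_of_lax u) \<in> Rels (oplax_presentation C)"
    if "(t, u) \<in> Rels (lax_presentation (opcat C))" for t u
    using that by (auto simp: oplax_presentation_def lax_presentation_def oplax_rels_def lax_rels_def)
qed (auto simp: oplax_of_lax_inverse lax_of_oplax_inverse oplax_presentation_def
    lax_presentation_def)

theorem corollary2p5:
  fixes C :: "('o, 'm) smcat"
  assumes "strict_monoidal_category C"
  shows "is_presented_by (oplax_classifier C) (oplax_presentation C) (\<lambda>x. [x]) (oplax_interp C)"
proof -
  interpret reversal_bij "oplax_presentation C" "lax_presentation (opcat C)"
    lax_of_oplax oplax_of_lax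
    by (rule reversal_bij_oplax_lax[OF assms])
  \<comment> \<open>Shows that the isomorphism gives the generators their prescribed values.\<close>
  have "rev_tm lax_of_oplax ` cls (oplax_presentation C) (Gen g) = oplax_interp C g" for g
    by (cases g) (simp_all add: image_rev_cls)
  with strict_monoidal_iso_rev fwd.wf_P show ?thesis
    unfolding is_presented_by_def oplax_classifier_def lax_classifier_def by blast
qed

end
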